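(* Let $\Theta=\{\theta_1<\dots<\theta_K\}$ with $\theta_1>0$, and let $w\in\overline{\mathcal{R}}$ (strictly redistributive). Then the following are equivalent: (1) for every $\mu\in\Delta(\Theta)$, every $(\mathrm{P}^\star_{w,\mu})$-optimal segmentation is strongly monotone; (2) $w$ is strongly redistributive.
   Context: Setting. $\Theta=\{\theta_1<\dots<\theta_K\}$ is a finite set of positive reals (buyer types) and $P=\Theta$ (prices). $\Delta(X)$ is the set of all probability distributions on a finite set $X$ (not required to have full support). Segmentations. For $\mu\in\Delta(\Theta)$, $\Sigma(\mu)$ is the set of $\sigma\in\Delta(\Theta\times P)$ such that $\sum_{p\in P}\sigma(\theta,p)=\mu(\theta)$ for all $\theta\in\Theta$ and (obedience) for all $p,q\in P$, $p\sum_{\theta\ge p}\sigma(\theta,p)\ge q\sum_{\theta\ge q}\sigma(\theta,p)$. Let $\Omega=\{(\theta,p)\in\Theta\times P:\theta\ge p\}$ and $\Sigma^\star(\mu)=\{\sigma\in\Sigma(\mu):\operatorname{supp}(\sigma)\subseteq\Omega\}$. Let $\sigma_P(p)=\sum_{\theta}\sigma(\theta,p)$, and for $p\in\operatorname{supp}(\sigma_P)$ let $\sigma(\cdot\,|\,p)=\sigma(\cdot,p)/\sigma_P(p)$. Strictly redistributive welfare functions. $\overline{\mathcal{R}}$ is the set of $w:\Theta\times P\to\mathbb{R}$ such that: $w(\theta,p)=0$ if $\theta<p$ and $w(\theta,p)\ge0$ if $\theta\ge p$; for each $k$, $p\mapsto w(\theta_k,p)$ is strictly decreasing on $\{\theta_1,\dots,\theta_k\}$;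 and for all $\theta,\theta'\in\Theta$ and $p,p'\in P$ with $\theta'>\theta\ge p'>p$, $w(\theta,p)-w(\theta,p')> w(\theta',p)-w(\theta',p')$. Strongly redistributive. $w\in\overline{\mathcal{R}}$ is strongly redistributive if for any $p,\theta_k,\theta_\ell\in\Theta$ with $p<\theta_k<\theta_\ell$, $$[w(\theta_k,p)-w(\theta_k,\theta_k)]-[w(\theta_{k+1},p)-w(\theta_{k+1},\theta_k)]>\frac{\theta_{k+1}}{\theta_{k+1}-\theta_k}\,[w(\theta_\ell,\theta_k)-w(\theta_\ell,\theta_\ell)].$$ Optimality. $\sigma$ is $(\mathrm{P}^\star_{w,\mu})$-optimal if it maximizes $\sum_{(\theta,p)\in\Theta\times P}w(\theta,p)\sigma(\theta,p)$ over $\sigma\in\Sigma^\star(\mu)$. Strong monotonicity. $\sigma\in\Sigma^\star(\mu)$ is strongly monotone if for any $p,p'\in\operatorname{supp}(\sigma_P)$ with $p<p'$, $\max\operatorname{supp}(\sigma(\cdot\,|\,p))\le p'$. *)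

theory Defs
  imports "HOL-Probability.Probability_Mass_Function"
begin

text \<open>
  Types and prices are real numbers in the finite set \<open>\<Theta> = \<theta> ` {1..K}\<close>.
  Welfare functions are total on the reals, but only their values on
  \<open>\<Theta> \<times> \<Theta>\<close> matter.
\<close>

definition distributions :: "'a set \<Rightarrow> 'a pmf set" where
  "distributions X = {d. set_pmf d \<subseteq> X}"

definition segmentations :: "real set \<Rightarrow> real pmf \<Rightarrow> (real \<times> real) pmf set" where
  "segmentations \<Theta> \<mu> = {\<sigma> \<in> distributions (\<Theta> \<times> \<Theta>).
     (\<forall>t\<in>\<Theta>. (\<Sum>p\<in>\<Theta>. pmf \<sigma> (t, p)) = pmf \<mu> t) \<and>
     (\<forall>p\<in>\<Theta>. \<forall>q\<in>\<Theta>.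
        p * (\<Sum>t\<in>{t\<in>\<Theta>. t \<ge> p}. pmf \<sigma> (t, p)) \<ge> q * (\<Sum>t\<in>{t\<in>\<Theta>. t \<ge> q}. pmf \<sigma> (t, p)))}"

definition trade_region :: "real set \<Rightarrow> (real \<times> real) set" where
  "trade_region \<Theta> = {(t, p) \<in> \<Theta> \<times> \<Theta>. t \<ge> p}"

definition efficient_segmentations :: "real set \<Rightarrow> real pmf \<Rightarrow> (real \<times> real) pmf set" where
  "efficient_segmentations \<Theta> \<mu> = {\<sigma> \<in> segmentations \<Theta> \<mu>. set_pmf \<sigma> \<subseteq> trade_region \<Theta>}"

definition price_marginal :: "(real \<times> real) pmf \<Rightarrow> real pmf" where
  "price_marginal \<sigma> = map_pmf snd \<sigma>"

text \<open>Only meaningful for \<open>p\<close> in the support of the price marginal.\<close>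

definition segment :: "(real \<times> real) pmf \<Rightarrow> real \<Rightarrow> real pmf" where
  "segment \<sigma> p = map_pmf fst (cond_pmf \<sigma> {x. snd x = p})"

lemma pmf_price_marginal:
  assumes "finite \<Theta>" "\<sigma> \<in> distributions (\<Theta> \<times> \<Theta>)"
  shows "pmf (price_marginal \<sigma>) p = (\<Sum>t\<in>\<Theta>. pmf \<sigma> (t, p))"
proof -
  have "pmf (price_marginal \<sigma>) p = measure (measure_pmf \<sigma>) (snd -` {p})"
    by (simp add: price_marginal_def pmf_map)
  also have "\<dots> = measure (measure_pmf \<sigma>) ((\<lambda>t. (t, p)) ` \<Theta>)"
    using assms(2) by (intro measure_pmf.finite_measure_eq_AE)
      (auto simp: distributions_def AE_measure_pmf_iff)
  also have "\<dots> = (\<Sum>x\<in>(\<lambda>t. (t, p)) ` \<Theta>. pmf \<sigma> x)"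
    using assms(1) by (simp add: measure_measure_pmf_finite)
  also have "\<dots> = (\<Sum>t\<in>\<Theta>. pmf \<sigma> (t, p))"
    by (subst sum.reindex) (auto simp: inj_on_def)
  finally show ?thesis .
qed

lemma pmf_segment:
  assumes "p \<in> set_pmf (price_marginal \<sigma>)"
  shows "pmf (segment \<sigma> p) t = pmf \<sigma> (t, p) / pmf (price_marginal \<sigma>) p"
proof -
  let ?A = "{x :: real \<times> real. snd x = p}"
  have ne: "set_pmf \<sigma> \<inter> ?A \<noteq> {}"
    using assms by (auto simp: price_marginal_def)
  have vimage: "snd -` {p} = ?A"
    by auto
  have "pmf (segment \<sigma> p) t = measure (measure_pmf (cond_pmf \<sigma> ?A)) (fst -` {t})"
    by (simp add: segment_def pmf_map)
  also have "\<dots> = measure (measure_pmf (cond_pmf \<sigma> ?A)) {(t, p)}"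
    by (intro measure_pmf.finite_measure_eq_AE)
      (auto simp: AE_measure_pmf_iff set_cond_pmf[OF ne])
  also have "\<dots> = pmf (cond_pmf \<sigma> ?A) (t, p)"
    by (simp add: measure_pmf_single)
  also have "\<dots> = pmf \<sigma> (t, p) / pmf (price_marginal \<sigma>) p"
    by (simp add: pmf_cond[OF ne] price_marginal_def pmf_map vimage)
  finally show ?thesis .
qed

definition strictly_redistributive :: "(nat \<Rightarrow> real) \<Rightarrow> nat \<Rightarrow> (real \<Rightarrow> real \<Rightarrow> real) \<Rightarrow> bool" where
  "strictly_redistributive \<theta> K w \<longleftrightarrow> (let \<Theta> = \<theta> ` {1..K} in
     (\<forall>t\<in>\<Theta>. \<forall>p\<in>\<Theta>. (t < p \<longrightarrow> w t p = 0) \<and> (t \<ge> p \<longrightarrow> w t p \<ge> 0)) \<and>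
     (\<forall>k\<in>{1..K}. strict_antimono_on (\<theta> ` {1..k}) (w (\<theta> k))) \<and>
     (\<forall>t\<in>\<Theta>. \<forall>t'\<in>\<Theta>. \<forall>p\<in>\<Theta>. \<forall>p'\<in>\<Theta>.
        t' > t \<and> t \<ge> p' \<and> p' > p \<longrightarrow> w t p - w t p' > w t' p - w t' p'))"

definition strongly_redistributive :: "(nat \<Rightarrow> real) \<Rightarrow> nat \<Rightarrow> (real \<Rightarrow> real \<Rightarrow> real) \<Rightarrow> bool" where
  "strongly_redistributive \<theta> K w \<longleftrightarrow> strictly_redistributive \<theta> K w \<and>
     (\<forall>p\<in>\<theta> ` {1..K}. \<forall>k\<in>{1..K}. \<forall>l\<in>{1..K}. p < \<theta> k \<and> \<theta> k < \<theta> l \<longrightarrow>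
        (w (\<theta> k) p - w (\<theta> k) (\<theta> k)) - (w (\<theta> (k + 1)) p - w (\<theta> (k + 1)) (\<theta> k))
        > \<theta> (k + 1) / (\<theta> (k + 1) - \<theta> k) * (w (\<theta> l) (\<theta> k) - w (\<theta> l) (\<theta> l)))"

definition welfare :: "real set \<Rightarrow> (real \<Rightarrow> real \<Rightarrow> real) \<Rightarrow> (real \<times> real) pmf \<Rightarrow> real" where
  "welfare \<Theta> w \<sigma> = (\<Sum>(t, p)\<in>\<Theta> \<times> \<Theta>. w t p * pmf \<sigma> (t, p))"

definition optimal_segmentations ::
    "real set \<Rightarrow> (real \<Rightarrow> real \<Rightarrow> real) \<Rightarrow> real pmf \<Rightarrow> (real \<times> real) pmf set" where
  "optimal_segmentations \<Theta> w \<mu> = {\<sigma> \<in> efficient_segmentations \<Theta> \<mu>.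
     \<forall>\<tau>\<in>efficient_segmentations \<Theta> \<mu>. welfare \<Theta> w \<tau> \<le> welfare \<Theta> w \<sigma>}"

definition strongly_monotone :: "(real \<times> real) pmf \<Rightarrow> bool" where
  "strongly_monotone \<sigma> \<longleftrightarrow>
     (\<forall>p\<in>set_pmf (price_marginal \<sigma>). \<forall>p'\<in>set_pmf (price_marginal \<sigma>).
        p < p' \<longrightarrow> Max (set_pmf (segment \<sigma> p)) \<le> p')"

end

theory Submission
  imports Defs
begin

text \<open>For a fixed market the problem is a finite linear program. An optimum therefore admits
  no feasible direction of positive value, and a small step along one of value zero leads to another
  optimum (\<open>optimal_direction\<close>). Both implications rest on essentially one direction,
  run forwards and backwards.

  Suppose type m buys at p while a price k with p < k < m is in use. Then type k itself buys at k
  (\<open>own_type_in_segment\<close>). Exchanging a unit of k at price k with a unit of m at price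
  p gains welfare by decreasing differences, but makes segment k richer and higher prices there more
  tempting. With s the type after k and l the top type of segment k, moving s / (s - k) units of l
  to price l restores obedience. Strong redistributivity says that the gain exceeds the cost of this
  repair (\<open>optimal_strongly_monotone\<close>).

  Conversely, let the inequality fail at j < k < l. For suitable masses
  (\<open>critical_masses\<close>), every strongly monotone optimum leaves room for the reverse
  direction: s goes down to j, k goes up from j to k, and types l enter segment k. The failed
  inequality means that welfare does not drop, so the step ends at an optimum where s buys at j
  although k < s is in use (\<open>optimal_not_strongly_monotone\<close>). Compactness supplies the
  optimum to start from (\<open>optimal_segmentation_exists\<close>).\<close>

section \<open>Segmentations as real-valued plans\<close>

definition slack :: "real set \<Rightarrow> (real \<times> real \<Rightarrow> real) \<Rightarrow> real \<Rightarrow> real \<Rightarrow> real" where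
  "slack \<Theta> f p q =
     p * (\<Sum>t\<in>{t\<in>\<Theta>. t \<ge> p}. f (t, p)) - q * (\<Sum>t\<in>{t\<in>\<Theta>. t \<ge> q}. f (t, p))"

text \<open>Real functions replace pmfs so that plans and perturbations, which take both signs, live
  in one vector space. \<open>slack\<close> is the obedience margin of price \<open>p\<close>
  against the deviation \<open>q\<close>, linear in the plan.\<close>

definition plans :: "real set \<Rightarrow> (real \<Rightarrow> real) \<Rightarrow> (real \<times> real \<Rightarrow> real) set" where
  "plans \<Theta> m = {f. (\<forall>x. 0 \<le> f x) \<and> (\<forall>x. x \<notin> trade_region \<Theta> \<longrightarrow> f x = 0) \<and>
     (\<forall>t\<in>\<Theta>. (\<Sum>p\<in>\<Theta>. f (t, p)) = m t) \<and> (\<forall>p\<in>\<Theta>. \<forall>q\<in>\<Theta>. 0 \<le> slack \<Theta> f p q)}"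

lemma plansD:
  assumes "f \<in> plans \<Theta> m"
  shows plans_nonneg: "0 \<le> f x"
    and plans_outside_trade: "x \<notin> trade_region \<Theta> \<Longrightarrow> f x = 0"
    and plans_row: "t \<in> \<Theta> \<Longrightarrow> (\<Sum>p\<in>\<Theta>. f (t, p)) = m t"
    and plans_obedient: "p \<in> \<Theta> \<Longrightarrow> q \<in> \<Theta> \<Longrightarrow> 0 \<le> slack \<Theta> f p q"
  using assms unfolding plans_def by blast+

definition plan_value :: "real set \<Rightarrow> (real \<Rightarrow> real \<Rightarrow> real) \<Rightarrow> (real \<times> real \<Rightarrow> real) \<Rightarrow> real" where
  "plan_value \<Theta> w f = (\<Sum>(t, p)\<in>\<Theta> \<times> \<Theta>. w t p * f (t, p))"

definition unit_mass :: "real \<Rightarrow> real \<Rightarrow> real \<times> real \<Rightarrow> real" where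
  "unit_mass t p x = (if x = (t, p) then 1 else 0)"

lemma slack_add: "slack \<Theta> (\<lambda>x. f x + g x) p q = slack \<Theta> f p q + slack \<Theta> g p q"
  by (simp add: slack_def sum.distrib algebra_simps)

lemma slack_diff: "slack \<Theta> (\<lambda>x. f x - g x) p q = slack \<Theta> f p q - slack \<Theta> g p q"
  by (simp add: slack_def sum_subtractf algebra_simps)

lemma slack_cmult: "slack \<Theta> (\<lambda>x. c * f x) p q = c * slack \<Theta> f p q"
  by (simp add: slack_def sum_distrib_left algebra_simps)

lemma slack_unit_mass:
  assumes "finite \<Theta>" "t \<in> \<Theta>"
  shows "slack \<Theta> (unit_mass t p') p q =
    (if p = p' then (if t \<ge> p then p else 0) - (if t \<ge> q then q else 0) else 0)"
proof -
  have "(\<Sum>s\<in>{s\<in>\<Theta>. s \<ge> r}. unit_mass t p' (s, p)) = (if p = p' \<and> t \<ge> r then 1 else 0)" for r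
    using assms by (auto simp: unit_mass_def sum.delta)
  then show ?thesis by (simp add: slack_def)
qed

lemma plan_value_add: "plan_value \<Theta> w (\<lambda>x. f x + g x) = plan_value \<Theta> w f + plan_value \<Theta> w g"
  by (simp add: plan_value_def case_prod_beta sum.distrib algebra_simps)

lemma plan_value_diff: "plan_value \<Theta> w (\<lambda>x. f x - g x) = plan_value \<Theta> w f - plan_value \<Theta> w g"
  by (simp add: plan_value_def case_prod_beta sum_subtractf algebra_simps)

lemma plan_value_cmult: "plan_value \<Theta> w (\<lambda>x. c * f x) = c * plan_value \<Theta> w f"
  by (simp add: plan_value_def case_prod_beta sum_distrib_left algebra_simps)

lemma plan_value_unit_mass:
  assumes "finite \<Theta>" "t \<in> \<Theta>" "p \<in> \<Theta>"
  shows "plan_value \<Theta> w (unit_mass t p) = w t p"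
proof -
  have "plan_value \<Theta> w (unit_mass t p) = (\<Sum>x\<in>\<Theta> \<times> \<Theta>. if x = (t, p) then w t p else 0)"
    unfolding plan_value_def by (intro sum.cong) (auto simp: unit_mass_def split: if_splits)
  then show ?thesis using assms by (simp add: sum.delta)
qed

lemma sum_unit_mass:
  assumes "finite \<Theta>" "p \<in> \<Theta>"
  shows "(\<Sum>q\<in>\<Theta>. unit_mass t p (t', q)) = (if t = t' then 1 else 0)"
  using assms by (auto simp: unit_mass_def sum.delta)

lemmas plan_linear = slack_add slack_diff slack_cmult plan_value_add plan_value_diff plan_value_cmult

section \<open>Passage between plans and probability mass functions\<close>

lemma pmf_of_weights:
  fixes f :: "'a \<Rightarrow> real"
  assumes "finite A" "\<And>x. 0 \<le> f x" "\<And>x. x \<notin> A \<Longrightarrow> f x = 0" "sum f A = 1"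
  shows "\<exists>d. \<forall>x. pmf d x = f x"
proof -
  have "(\<integral>\<^sup>+x. ennreal (f x) \<partial>count_space UNIV) = (\<Sum>x\<in>A. ennreal (f x))"
  proof (rule nn_integral_count_space'[OF assms(1)])
    show "ennreal (f x) = 0" if "x \<in> UNIV" "x \<notin> A" for x
      using assms(3) that by simp
  qed auto
  also have "\<dots> = 1"
    using assms by (simp add: sum_ennreal)
  finally show ?thesis
    using assms(2) by (metis pmf_embed_pmf)
qed

lemma sum_pmf_distributions:
  assumes "finite A" "\<mu> \<in> distributions A"
  shows "sum (pmf \<mu>) A = 1"
  using assms by (auto simp: distributions_def intro: sum_pmf_eq_1)

lemma welfare_eq_plan_value: "welfare \<Theta> w \<sigma> = plan_value \<Theta> w (pmf \<sigma>)"
  by (simp add: welfare_def plan_value_def)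

lemma efficient_segmentations_iff:
  "\<sigma> \<in> efficient_segmentations \<Theta> \<mu> \<longleftrightarrow> pmf \<sigma> \<in> plans \<Theta> (pmf \<mu>)"
  unfolding efficient_segmentations_def segmentations_def distributions_def plans_def slack_def
    trade_region_def
  by (auto simp: set_pmf_iff subset_iff)

lemma plan_realizable:
  assumes "finite \<Theta>" "\<mu> \<in> distributions \<Theta>" "f \<in> plans \<Theta> (pmf \<mu>)"
  shows "\<exists>\<sigma>\<in>efficient_segmentations \<Theta> \<mu>. pmf \<sigma> = f"
proof -
  have "sum f (\<Theta> \<times> \<Theta>) = (\<Sum>t\<in>\<Theta>. \<Sum>p\<in>\<Theta>. f (t, p))"
    by (simp add: sum.cartesian_product)
  also have "\<dots> = 1"
    using assms(3) sum_pmf_distributions[OF assms(1,2)] by (simp add: plans_def)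
  finally have "\<exists>d. \<forall>x. pmf d x = f x"
    using assms by (intro pmf_of_weights[of "\<Theta> \<times> \<Theta>"]) (auto simp: plans_def trade_region_def)
  then obtain \<sigma> where "pmf \<sigma> = f" by (auto simp del: split_paired_All)
  then show ?thesis using assms(3) efficient_segmentations_iff by blast
qed

lemma plans_le_1:
  assumes "finite \<Theta>" "f \<in> plans \<Theta> (pmf \<mu>)"
  shows "f x \<le> 1"
proof (cases "x \<in> trade_region \<Theta>")
  case True
  then obtain t p where x: "x = (t, p)" "t \<in> \<Theta>" "p \<in> \<Theta>" by (auto simp: trade_region_def)
  have "f (t, p) \<le> (\<Sum>p\<in>\<Theta>. f (t, p))"
    using assms x by (intro member_le_sum) (auto simp: plans_def)
  also have "\<dots> \<le> 1" using assms x by (simp add: plans_def pmf_le_1)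
  finally show ?thesis using x by simp
next
  case False
  then show ?thesis using assms by (auto simp: plans_def simp del: split_paired_All)
qed

section \<open>Existence of optimal segmentations\<close>

text \<open>Plans form a closed subset of a product of unit intervals, which is compact by
  Tychonoff; each constraint involves only finitely many coordinates and is thus closed in the
  product topology.\<close>

lemma compact_plans:
  assumes "finite \<Theta>"
  shows "compact (plans \<Theta> (pmf \<mu>))"
proof -
  have "compactin (product_topology (\<lambda>_::real \<times> real. euclidean) UNIV) (PiE UNIV (\<lambda>_. {0..1::real}))"
    by (subst compactin_PiE) auto
  then have box: "compact (PiE UNIV (\<lambda>_::real \<times> real. {0..1::real}))"
    by (simp add: euclidean_product_topology)
  have cont: "continuous_on UNIV (\<lambda>f::real \<times> real \<Rightarrow> real. f x)" for x
    by simp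
  have "closed {f :: real \<times> real \<Rightarrow> real. (\<forall>x. 0 \<le> f x) \<and> (\<forall>x. x \<notin> trade_region \<Theta> \<longrightarrow> f x = 0) \<and>
     (\<forall>t\<in>\<Theta>. (\<Sum>p\<in>\<Theta>. f (t, p)) = pmf \<mu> t) \<and> (\<forall>p\<in>\<Theta>. \<forall>q\<in>\<Theta>. 0 \<le> slack \<Theta> f p q)}"
    unfolding slack_def Ball_def
    by (intro closed_Collect_conj closed_Collect_all closed_Collect_imp closed_Collect_le
        closed_Collect_eq open_Collect_const continuous_intros cont)
  then have "closed (plans \<Theta> (pmf \<mu>))"
    by (simp add: plans_def)
  moreover have "plans \<Theta> (pmf \<mu>) = PiE UNIV (\<lambda>_. {0..1}) \<inter> plans \<Theta> (pmf \<mu>)"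
    using plans_le_1[OF assms, of _ \<mu>] by (fastforce simp: plans_def simp del: split_paired_All)
  ultimately show ?thesis
    using box compact_Int_closed by metis
qed

lemma continuous_on_plan_value: "continuous_on S (plan_value \<Theta> w)"
  unfolding plan_value_def case_prod_beta
  by (intro continuous_intros continuous_on_subset[OF continuous_on_product_coordinates]) auto

text \<open>When everyone pays exactly their type, a higher price sells nothing and a lower one
  sells to the same buyers for less. This makes the set of plans nonempty.\<close>

lemma full_discrimination_plan:
  assumes "finite \<Theta>" "\<And>t. t \<in> \<Theta> \<Longrightarrow> t > 0"
  shows "(\<lambda>(t, p). if t \<in> \<Theta> \<and> p = t then pmf \<mu> t else 0) \<in> plans \<Theta> (pmf \<mu>)"
    (is "?f \<in> _")
proof -
  have "(\<Sum>t\<in>{t\<in>\<Theta>. t \<ge> q}. ?f (t, p)) = (if p \<ge> q then pmf \<mu> p else 0)" if "p \<in> \<Theta>" for p q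
  proof -
    have "(\<Sum>t\<in>{t\<in>\<Theta>. t \<ge> q}. ?f (t, p)) = (\<Sum>t\<in>{t\<in>\<Theta>. t \<ge> q}. if t = p then pmf \<mu> p else 0)"
      by (intro sum.cong) auto
    then show ?thesis using assms(1) that by (simp add: sum.delta)
  qed
  then have "0 \<le> slack \<Theta> ?f p q" if "p \<in> \<Theta>" "q \<in> \<Theta>" for p q
    using that assms(2)[of p] by (auto simp: slack_def mult_right_mono)
  then show ?thesis
    using assms(1) by (auto simp: plans_def trade_region_def sum.delta)
qed

lemma optimal_segmentation_exists:
  assumes "finite \<Theta>" "\<And>t. t \<in> \<Theta> \<Longrightarrow> t > 0" "\<mu> \<in> distributions \<Theta>"
  shows "\<exists>\<sigma>. \<sigma> \<in> optimal_segmentations \<Theta> w \<mu>"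
proof -
  have "plans \<Theta> (pmf \<mu>) \<noteq> {}"
    using full_discrimination_plan[OF assms(1,2)] by blast
  then obtain f where f: "f \<in> plans \<Theta> (pmf \<mu>)"
    "\<forall>g\<in>plans \<Theta> (pmf \<mu>). plan_value \<Theta> w g \<le> plan_value \<Theta> w f"
    using continuous_attains_sup[OF compact_plans[OF assms(1)] _ continuous_on_plan_value] by blast
  then obtain \<sigma> where "\<sigma> \<in> efficient_segmentations \<Theta> \<mu>" "pmf \<sigma> = f"
    using plan_realizable assms by metis
  then show ?thesis
    using f by (auto simp: optimal_segmentations_def welfare_eq_plan_value efficient_segmentations_iff)
qed

text \<open>Finite support turns the maximum into a bound on each type of positive mass, so that a
  violation is just a pair of points.\<close>

lemma strongly_monotone_iff:
  assumes "finite (set_pmf \<sigma>)"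
  shows "strongly_monotone \<sigma> \<longleftrightarrow>
    (\<forall>t p t' p'. pmf \<sigma> (t, p) > 0 \<and> pmf \<sigma> (t', p') > 0 \<and> p < p' \<longrightarrow> t \<le> p')"
proof -
  have supp: "p \<in> set_pmf (price_marginal \<sigma>) \<longleftrightarrow> (\<exists>t. pmf \<sigma> (t, p) > 0)" for p
    by (force simp: price_marginal_def pmf_positive_iff)
  have seg: "set_pmf (segment \<sigma> p) = {t. pmf \<sigma> (t, p) > 0}" if "p \<in> set_pmf (price_marginal \<sigma>)" for p
    using pmf_segment[OF that] that
    by (auto simp: set_pmf_eq pmf_nonneg less_le)
  have fin: "finite {t. pmf \<sigma> (t, p) > 0}" for p
    by (rule finite_subset[OF _ finite_imageI[OF assms, of fst]]) (force simp: pmf_positive_iff)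
  have "Max (set_pmf (segment \<sigma> p)) \<le> p' \<longleftrightarrow> (\<forall>t. pmf \<sigma> (t, p) > 0 \<longrightarrow> t \<le> p')"
    if "p \<in> set_pmf (price_marginal \<sigma>)" for p p'
    using fin[of p] that supp[of p] by (subst seg[OF that], subst Max_le_iff) auto
  then show ?thesis
    unfolding strongly_monotone_def using supp by (metis (no_types, lifting))
qed


section \<open>First-order conditions for optimality\<close>

text \<open>Each inequality constraint either has room at \<open>f\<close> or is not worsened by
  \<open>d\<close>. Only upward deviations \<open>p < q\<close> are listed;
  \<open>slack_below_price\<close> takes care of the others.\<close>

definition feasible_direction ::
    "real set \<Rightarrow> (real \<times> real \<Rightarrow> real) \<Rightarrow> (real \<times> real \<Rightarrow> real) \<Rightarrow> bool" where
  "feasible_direction \<Theta> f d \<longleftrightarrow>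
     (\<forall>x. x \<notin> trade_region \<Theta> \<longrightarrow> d x = 0) \<and> (\<forall>t\<in>\<Theta>. (\<Sum>p\<in>\<Theta>. d (t, p)) = 0) \<and>
     (\<forall>x. f x > 0 \<or> d x \<ge> 0) \<and>
     (\<forall>p\<in>\<Theta>. \<forall>q\<in>\<Theta>. p < q \<longrightarrow> slack \<Theta> f p q > 0 \<or> slack \<Theta> d p q \<ge> 0)"

lemma small_step_exists:
  fixes a b :: "'i \<Rightarrow> real"
  assumes "finite I" "\<And>i. i \<in> I \<Longrightarrow> 0 \<le> a i" "\<And>i. i \<in> I \<Longrightarrow> 0 < a i \<or> 0 \<le> b i"
  shows "\<forall>\<^sub>F s in at_right 0. \<forall>i\<in>I. 0 \<le> a i + s * b i"
proof (rule eventually_ball_finite[OF assms(1)], rule ballI)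
  fix i assume i: "i \<in> I"
  show "\<forall>\<^sub>F s in at_right 0. 0 \<le> a i + s * b i"
  proof (cases "0 \<le> b i")
    case True
    have "\<forall>\<^sub>F s::real in at_right 0. 0 < s"
      by (simp add: eventually_at_right_less)
    then show ?thesis
      by eventually_elim (use True assms(2)[OF i] in auto)
  next
    case False
    have "((\<lambda>s. a i + s * b i) \<longlongrightarrow> a i + 0 * b i) (at_right 0)"
      by (intro tendsto_intros)
    then have "\<forall>\<^sub>F s in at_right 0. 0 < a i + s * b i"
      using False assms(3)[OF i] by (intro order_tendstoD(1)) auto
    then show ?thesis by eventually_elim auto
  qed
qed

text \<open>All mass in column \<open>p\<close> sits at types at least \<open>p\<close>, so all of
  it counts at any price up to \<open>p\<close>.\<close>

lemma slack_below_price: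
  assumes "finite \<Theta>" "\<And>x. x \<notin> trade_region \<Theta> \<Longrightarrow> f x = 0" "q \<le> p"
  shows "slack \<Theta> f p q = (p - q) * (\<Sum>t\<in>\<Theta>. f (t, p))"
proof -
  have "(\<Sum>t\<in>{t\<in>\<Theta>. t \<ge> r}. f (t, p)) = (\<Sum>t\<in>\<Theta>. f (t, p))" if "r \<le> p" for r
    using that assms(1) by (intro sum.mono_neutral_left ballI assms(2)) (auto simp: trade_region_def)
  then show ?thesis using assms(3) by (simp add: slack_def algebra_simps)
qed

lemma perturbed_plan:
  assumes fin: "finite \<Theta>" and f: "f \<in> plans \<Theta> m" and d: "feasible_direction \<Theta> f d"
  shows "\<exists>s>0. (\<lambda>x. f x + s * d x) \<in> plans \<Theta> m"
proof -
  have pos: "\<forall>\<^sub>F s::real in at_right 0. 0 < s"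
    by (simp add: eventually_at_right_less)
  have nonneg: "\<forall>\<^sub>F s in at_right 0. \<forall>x\<in>\<Theta> \<times> \<Theta>. 0 \<le> f x + s * d x"
    using fin plans_nonneg[OF f] d
    by (intro small_step_exists) (auto simp: feasible_direction_def)
  have "finite {z\<in>\<Theta> \<times> \<Theta>. fst z < snd z}"
    using fin by simp
  then have obed: "\<forall>\<^sub>F s in at_right 0. \<forall>z\<in>{z\<in>\<Theta> \<times> \<Theta>. fst z < snd z}.
      0 \<le> slack \<Theta> f (fst z) (snd z) + s * slack \<Theta> d (fst z) (snd z)"
  proof (rule small_step_exists)
    fix z assume "z \<in> {z\<in>\<Theta> \<times> \<Theta>. fst z < snd z}"
    then have z: "fst z \<in> \<Theta>" "snd z \<in> \<Theta>" "fst z < snd z" by auto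
    show "0 \<le> slack \<Theta> f (fst z) (snd z)" by (rule plans_obedient[OF f z(1,2)])
    show "0 < slack \<Theta> f (fst z) (snd z) \<or> 0 \<le> slack \<Theta> d (fst z) (snd z)"
      using d z unfolding feasible_direction_def by blast
  qed
  have "\<forall>\<^sub>F s in at_right 0. 0 < s \<and> (\<lambda>x. f x + s * d x) \<in> plans \<Theta> m"
    using pos nonneg obed
  proof eventually_elim
    case (elim s)
    let ?g = "\<lambda>x. f x + s * d x"
    have trade: "?g x = 0" if "x \<notin> trade_region \<Theta>" for x
      using plans_outside_trade[OF f that] d that
      unfolding feasible_direction_def by (metis add_0 mult_zero_right)
    have ge: "0 \<le> ?g x" for x
      using trade[of x] elim(2) by (cases "x \<in> trade_region \<Theta>") (auto simp: trade_region_def)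
    have "0 \<le> slack \<Theta> ?g p q" if "p \<in> \<Theta>" "q \<in> \<Theta>" for p q
    proof (cases "p < q")
      case True
      then show ?thesis using elim(3) that by (auto simp: slack_add slack_cmult)
    next
      case False
      have "0 \<le> (p - q) * (\<Sum>t\<in>\<Theta>. ?g (t, p))"
        using False ge by (intro mult_nonneg_nonneg sum_nonneg) auto
      then show ?thesis
        using slack_below_price[where f = ?g and q = q and p = p, OF fin trade] False by simp
    qed
    moreover have "(\<Sum>p\<in>\<Theta>. ?g (t, p)) = m t" if "t \<in> \<Theta>" for t
      using that plans_row[OF f that] d
      by (simp add: feasible_direction_def sum.distrib flip: sum_distrib_left)
    ultimately show ?case
      using elim(1) ge trade unfolding plans_def by blast
  qed
  then show ?thesis
    by (metis (no_types, lifting) eventually_happens trivial_limit_at_right_real)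
qed

text \<open>A small step along \<open>d\<close> stays feasible and changes welfare linearly. The
  second conclusion handles equality in the failed inequality, where no strict improvement is
  available.\<close>

lemma optimal_direction:
  assumes fin: "finite \<Theta>" and \<mu>: "\<mu> \<in> distributions \<Theta>" and \<sigma>: "\<sigma> \<in> optimal_segmentations \<Theta> w \<mu>"
    and d: "feasible_direction \<Theta> (pmf \<sigma>) d"
  shows "plan_value \<Theta> w d \<le> 0"
    and "plan_value \<Theta> w d = 0 \<Longrightarrow>
      \<exists>\<tau>\<in>optimal_segmentations \<Theta> w \<mu>. \<exists>s>0. pmf \<tau> = (\<lambda>x. pmf \<sigma> x + s * d x)"
proof -
  have f: "pmf \<sigma> \<in> plans \<Theta> (pmf \<mu>)"
    using \<sigma> by (simp add: optimal_segmentations_def efficient_segmentations_iff)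
  obtain s where s: "s > 0" "(\<lambda>x. pmf \<sigma> x + s * d x) \<in> plans \<Theta> (pmf \<mu>)"
    using perturbed_plan[OF fin f d] by blast
  then obtain \<tau> where \<tau>: "\<tau> \<in> efficient_segmentations \<Theta> \<mu>" "pmf \<tau> = (\<lambda>x. pmf \<sigma> x + s * d x)"
    using plan_realizable[OF fin \<mu>] by blast
  have val: "welfare \<Theta> w \<tau> = welfare \<Theta> w \<sigma> + s * plan_value \<Theta> w d"
    by (simp add: welfare_eq_plan_value \<tau>(2) plan_linear)
  have "welfare \<Theta> w \<tau> \<le> welfare \<Theta> w \<sigma>"
    using \<tau>(1) \<sigma> by (simp add: optimal_segmentations_def)
  then show "plan_value \<Theta> w d \<le> 0"
    using s(1) by (simp add: val mult_le_0_iff)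
  show "\<exists>\<tau>\<in>optimal_segmentations \<Theta> w \<mu>. \<exists>s>0. pmf \<tau> = (\<lambda>x. pmf \<sigma> x + s * d x)"
    if "plan_value \<Theta> w d = 0"
    using \<tau> s(1) val that \<sigma> by (auto simp: optimal_segmentations_def intro!: bexI[of _ \<tau>])
qed

section \<open>Support and slack within one segment\<close>

lemma plan_support:
  assumes "f \<in> plans \<Theta> m" "f (t, p) > 0"
  shows "t \<in> \<Theta>" "p \<in> \<Theta>" "p \<le> t"
  using plans_outside_trade[OF assms(1), of "(t, p)"] assms(2) by (auto simp: trade_region_def)

text \<open>If the lowest type buying at \<open>p\<close> were above \<open>p\<close>, charging that type would be more profitable.\<close>

lemma own_type_in_segment:
  assumes fin: "finite \<Theta>" and f: "f \<in> plans \<Theta> m" and pos: "f (t, p) > 0"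
  shows "f (p, p) > 0"
proof (rule ccontr)
  assume "\<not> f (p, p) > 0"
  define S where "S = {t\<in>\<Theta>. f (t, p) > 0}"
  have S: "finite S" "t \<in> S" using fin plan_support[OF f pos] pos by (auto simp: S_def)
  define q where "q = Min S"
  have q: "q \<in> S" using S Min_in unfolding q_def by blast
  then have "p < q"
    using plan_support[OF f, of q p] \<open>\<not> f (p, p) > 0\<close> by (cases "p = q") (auto simp: S_def)
  note ge = plans_nonneg[OF f]
  \<comment> \<open>Up to \<open>q\<close>, the lowest type in the segment, raising the price loses
    no buyer.\<close>
  have "(\<Sum>t\<in>{t\<in>\<Theta>. t \<ge> r}. f (t, p)) = sum (\<lambda>t. f (t, p)) S" if "r \<le> q" for r
  proof (intro sum.mono_neutral_right)
    show "S \<subseteq> {t\<in>\<Theta>. t \<ge> r}"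
      using Min_le[OF S(1)] that unfolding q_def by (force simp: S_def)
    show "\<forall>t\<in>{t\<in>\<Theta>. t \<ge> r} - S. f (t, p) = 0"
      using ge by (auto simp: S_def not_less intro: antisym)
  qed (use fin in auto)
  then have "slack \<Theta> f p q = (p - q) * sum (\<lambda>t. f (t, p)) S"
    using \<open>p < q\<close> by (simp add: slack_def algebra_simps)
  moreover have "sum (\<lambda>t. f (t, p)) S > 0"
    using S by (intro sum_pos) (auto simp: S_def)
  ultimately have "slack \<Theta> f p q < 0"
    using \<open>p < q\<close> by (simp add: mult_neg_pos)
  moreover have "slack \<Theta> f p q \<ge> 0"
    using f q plan_support[OF f pos] by (auto simp: plans_def S_def)
  ultimately show False by simp
qed

text \<open>Nobody in the segment buys at \<open>q\<close>, while \<open>p\<close> earns at least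
  \<open>p * f (p, p)\<close>.\<close>

lemma slack_pos_above_top:
  assumes fin: "finite \<Theta>" and f: "f \<in> plans \<Theta> m" and "p > 0" "f (p, p) > 0"
    and top: "\<And>t. t \<in> \<Theta> \<Longrightarrow> q \<le> t \<Longrightarrow> f (t, p) = 0"
  shows "slack \<Theta> f p q > 0"
proof -
  have p: "p \<in> \<Theta>" using plan_support[OF f assms(4)] by simp
  have "f (p, p) \<le> (\<Sum>t\<in>{t\<in>\<Theta>. t \<ge> p}. f (t, p))"
    using fin f p by (intro member_le_sum[where f="\<lambda>t. f (t, p)"]) (auto simp: plans_def)
  then show ?thesis using assms by (simp add: slack_def)
qed


lemma unit_mass_outside_trade:
  "t \<in> \<Theta> \<Longrightarrow> p \<in> \<Theta> \<Longrightarrow> p \<le> t \<Longrightarrow> x \<notin> trade_region \<Theta> \<Longrightarrow> unit_mass t p x = 0"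
  by (auto simp: unit_mass_def trade_region_def)

lemma unit_mass_nonneg: "0 \<le> unit_mass t p x"
  by (simp add: unit_mass_def)

section \<open>Sufficiency of strong redistributivity\<close>

locale redistributive_market =
  fixes \<Theta> :: "real set" and w :: "real \<Rightarrow> real \<Rightarrow> real"
  assumes fin: "finite \<Theta>"
    and types_pos: "t \<in> \<Theta> \<Longrightarrow> t > 0"
    and price_decreasing: "t \<in> \<Theta> \<Longrightarrow> p \<in> \<Theta> \<Longrightarrow> q \<in> \<Theta> \<Longrightarrow> p < q \<Longrightarrow> q \<le> t \<Longrightarrow> w t q < w t p"
    and decreasing_differences: "t \<in> \<Theta> \<Longrightarrow> t' \<in> \<Theta> \<Longrightarrow> p \<in> \<Theta> \<Longrightarrow> p' \<in> \<Theta> \<Longrightarrow>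
      t < t' \<Longrightarrow> p' \<le> t \<Longrightarrow> p < p' \<Longrightarrow> w t' p - w t' p' < w t p - w t p'"
begin

text \<open>Swapping a type \<open>k\<close> from segment \<open>k\<close> with a type \<open>m > k\<close> from segment \<open>p < k\<close> raises
  welfare, but may break obedience in segment \<open>k\<close>. Obedience is restored by moving \<open>c\<close> units of
  the top type \<open>l\<close> of segment \<open>k\<close> to its own segment; \<open>q / (q - k)\<close> units suffice for deviation
  \<open>q\<close>, and this is largest at the successor \<open>s\<close> of \<open>k\<close>.\<close>

lemma optimal_strongly_monotone:
  assumes \<mu>: "\<mu> \<in> distributions \<Theta>" and \<sigma>: "\<sigma> \<in> optimal_segmentations \<Theta> w \<mu>"
    and strong: "\<And>p k s l. p \<in> \<Theta> \<Longrightarrow> k \<in> \<Theta> \<Longrightarrow> s \<in> \<Theta> \<Longrightarrow> l \<in> \<Theta> \<Longrightarrow> p < k \<Longrightarrow> k < s \<Longrightarrow> s \<le> l \<Longrightarrow>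
      (\<And>t. t \<in> \<Theta> \<Longrightarrow> k < t \<Longrightarrow> s \<le> t) \<Longrightarrow>
      s / (s - k) * (w l k - w l l) < (w k p - w k k) - (w s p - w s k)"
  shows "strongly_monotone \<sigma>"
proof (rule ccontr)
  assume not_mono: "\<not> strongly_monotone \<sigma>"
  define f where "f = pmf \<sigma>"
  have f: "f \<in> plans \<Theta> (pmf \<mu>)"
    using \<sigma> by (simp add: f_def optimal_segmentations_def efficient_segmentations_iff)
  have "set_pmf \<sigma> \<subseteq> \<Theta> \<times> \<Theta>"
    using \<sigma> by (auto simp: optimal_segmentations_def efficient_segmentations_def trade_region_def)
  then have "finite (set_pmf \<sigma>)"
    using fin finite_subset by blast
  then obtain m p t k where "f (m, p) > 0" "f (t, k) > 0" "p < k" "k < m"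
    using not_mono strongly_monotone_iff unfolding f_def by (metis not_le)
  then have pos: "f (m, p) > 0" "f (k, k) > 0" and "p < k" "k < m"
    using own_type_in_segment[OF fin f] by auto
  have in\<Theta>: "m \<in> \<Theta>" "p \<in> \<Theta>" "k \<in> \<Theta>"
    using plan_support[OF f] pos by auto
  have gt0: "p > 0" "k > 0" "m > 0"
    using in\<Theta> types_pos by auto
  note ge = plans_nonneg[OF f]
  define S where "S = {t\<in>\<Theta>. f (t, k) > 0}"
  have S: "finite S" "k \<in> S" using fin in\<Theta> pos by (auto simp: S_def)
  define l where "l = Max S"
  have l: "l \<in> \<Theta>" "f (l, k) > 0" "k \<le> l"
    using S Max_in[of S] Max_ge[of S k] unfolding l_def by (auto simp: S_def)
  have "f (t, k) = 0" if "t \<in> \<Theta>" "l < t" for t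
  proof -
    have "t \<notin> S" using that(2) Max_ge[OF S(1), of t] unfolding l_def by linarith
    then show ?thesis using that(1) ge[of "(t, k)"] by (simp add: S_def)
  qed
  then have above_l: "slack \<Theta> f k q > 0" if "l < q" for q
    using that by (intro slack_pos_above_top[OF fin f gt0(2) pos(2)]) auto
  define swap where "swap = (\<lambda>x. unit_mass k p x - unit_mass k k x + unit_mass m k x - unit_mass m p x)"
  have swap_slack: "slack \<Theta> swap p' q = 
      (if p' = p then (if m \<ge> q then q else 0) - (if k \<ge> q then q else 0) else 0) -
      (if p' = k then (if m \<ge> q then q else 0) - (if k \<ge> q then q else 0) else 0)" for p' q
    using \<open>p < k\<close> \<open>k < m\<close> by (simp add: swap_def plan_linear slack_unit_mass[OF fin] in\<Theta>)
  have swap_value: "plan_value \<Theta> w swap = (w k p - w k k) - (w m p - w m k)"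
    by (simp add: swap_def plan_linear plan_value_unit_mass[OF fin] in\<Theta>)
  have swap_nonneg: "f x > 0 \<or> swap x \<ge> 0" for x
    using pos \<open>p < k\<close> \<open>k < m\<close> unfolding swap_def by (auto simp: unit_mass_def)
  have swap_trade: "swap x = 0" if "x \<notin> trade_region \<Theta>" for x
    using that in\<Theta> \<open>p < k\<close> \<open>k < m\<close> by (simp add: swap_def unit_mass_outside_trade[where \<Theta>=\<Theta>])
  have swap_rows: "(\<Sum>q\<in>\<Theta>. swap (t, q)) = 0" for t
    by (simp add: swap_def sum.distrib sum_subtractf sum_unit_mass[OF fin] in\<Theta>)
  show False
  proof (cases "l = k")
    \<comment> \<open>Segment \<open>k\<close> contains only type \<open>k\<close>, so every higher
      price already has positive slack there and the swap is feasible without repair.\<close>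
    case True
    have "slack \<Theta> f p' q > 0 \<or> slack \<Theta> swap p' q \<ge> 0" if "p' \<in> \<Theta>" "q \<in> \<Theta>" "p' < q" for p' q
      using that above_l[of q] True gt0 \<open>p < k\<close> \<open>k < m\<close> by (auto simp: swap_slack)
    then have "feasible_direction \<Theta> f swap"
      using swap_nonneg swap_trade swap_rows by (auto simp: feasible_direction_def)
    then have "plan_value \<Theta> w swap \<le> 0"
      using optimal_direction(1)[OF fin \<mu> \<sigma>] by (simp add: f_def)
    then show False
      using decreasing_differences[of k m p k] in\<Theta> \<open>p < k\<close> \<open>k < m\<close> by (simp add: swap_value)
  next
    case False
    define U where "U = {t\<in>\<Theta>. k < t}"
    have U: "finite U" "m \<in> U" "l \<in> U" using fin in\<Theta> \<open>k < m\<close> l False by (auto simp: U_def)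
    define s where "s = Min U"
    have "s \<in> U" using U Min_in unfolding s_def by blast
    then have s: "s \<in> \<Theta>" "k < s" by (auto simp: U_def)
    have next_type: "s \<le> t" if "t \<in> \<Theta>" "k < t" for t
      using U(1) that by (auto simp: s_def U_def)
    have "s \<le> m" "s \<le> l" using next_type U by (auto simp: U_def)
    define c where "c = s / (s - k)"
    have c: "c > 0" "c * (s - k) = s" using s gt0 by (auto simp: c_def)
    define d where "d = (\<lambda>x. swap x + c * (unit_mass l l x - unit_mass l k x))"
    have d_slack: "slack \<Theta> d p' q = slack \<Theta> swap p' q +
      c * ((if p' = l then l - (if l \<ge> q then q else 0) else 0)
         - (if p' = k then k - (if l \<ge> q then q else 0) else 0))" for p' q
      using \<open>k \<le> l\<close> by (simp add: d_def plan_linear slack_unit_mass[OF fin] l)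
    have "slack \<Theta> f p' q > 0 \<or> slack \<Theta> d p' q \<ge> 0" if q: "q \<in> \<Theta>" "p' < q" for p' q
    proof (cases "p' = k")
      case True
      show ?thesis
      proof (cases "l < q")
        case True
        then show ?thesis using above_l \<open>p' = k\<close> by simp
      next
        case False
        \<comment> \<open>Since \<open>s * (c - 1) = c * k\<close>, this is the claim that
          \<open>c\<close> units repair the deviation \<open>q\<close>.\<close>
        have "q * (c - 1) \<ge> s * (c - 1)"
          using next_type[OF q(1)] q(2) True c s gt0
          by (intro mult_right_mono) (auto simp: c_def field_simps)
        then have "c * (q - k) \<ge> q"
          using c(2) by (simp add: algebra_simps)
        then show ?thesis
          using False True \<open>p < k\<close> \<open>k \<le> l\<close> \<open>l \<noteq> k\<close> q gt0 by (auto simp: d_slack swap_slack algebra_simps)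
      qed
    next
      case False
      have "c * l \<ge> 0" using c(1) types_pos[OF l(1)] by simp
      then show ?thesis
        using False q gt0 \<open>p < k\<close> \<open>k < m\<close> \<open>k \<le> l\<close> \<open>l \<noteq> k\<close> by (auto simp: d_slack swap_slack)
    qed
    moreover have "f x > 0 \<or> d x \<ge> 0" for x
    proof (cases "x = (l, k)")
      case False
      then have "d x = swap x + c * unit_mass l l x" by (simp add: d_def unit_mass_def)
      moreover have "c * unit_mass l l x \<ge> 0" using c(1) unit_mass_nonneg by simp
      ultimately show ?thesis using swap_nonneg[of x] by linarith
    qed (use l in simp)
    moreover have "d x = 0" if "x \<notin> trade_region \<Theta>" for x
      using that in\<Theta> l swap_trade by (simp add: d_def unit_mass_outside_trade[where \<Theta>=\<Theta>])
    moreover have "(\<Sum>q\<in>\<Theta>. d (t, q)) = 0" for t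
      by (simp add: d_def sum.distrib sum_subtractf sum_unit_mass[OF fin] in\<Theta> l swap_rows
          flip: sum_distrib_left)
    ultimately have "feasible_direction \<Theta> f d"
      unfolding feasible_direction_def by blast
    then have "plan_value \<Theta> w d \<le> 0"
      using optimal_direction(1)[OF fin \<mu> \<sigma>] by (simp add: f_def)
    moreover have "plan_value \<Theta> w d = plan_value \<Theta> w swap + c * (w l l - w l k)"
      by (simp add: d_def plan_linear plan_value_unit_mass[OF fin] in\<Theta> l)
    moreover have "c * (w l k - w l l) < (w k p - w k k) - (w s p - w s k)"
      unfolding c_def using in\<Theta> s l \<open>p < k\<close> \<open>s \<le> l\<close> next_type by (intro strong) auto
    \<comment> \<open>Decreasing differences reduce the swapped type \<open>m\<close> to the
      successor \<open>s\<close>, the type for which the hypothesis is stated.\<close>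
    moreover have "w m p - w m k \<le> w s p - w s k"
      using decreasing_differences[of s m p k] in\<Theta> s \<open>s \<le> m\<close> \<open>p < k\<close> by (cases "s = m") auto
    ultimately show False
      by (simp add: swap_value algebra_simps)
  qed
qed

section \<open>Necessity of strong redistributivity\<close>

text \<open>Moving the top type \<open>l\<close> of segment \<open>p\<close> down to
  \<open>p'\<close> raises welfare. Losing its top type does not hurt obedience in segment
  \<open>p\<close>: prices in \<open>(p, l]\<close> become less attractive and those above
  \<open>l\<close> sell nothing. Segment \<open>p'\<close> absorbs the newcomer by the assumed
  slack.\<close>

lemma no_improving_top_move:
  assumes \<mu>: "\<mu> \<in> distributions \<Theta>" and \<sigma>: "\<sigma> \<in> optimal_segmentations \<Theta> w \<mu>"
    and pos: "pmf \<sigma> (l, p) > 0" and top: "\<And>t. t \<in> \<Theta> \<Longrightarrow> l < t \<Longrightarrow> pmf \<sigma> (t, p) = 0"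
    and p': "p' \<in> \<Theta>" "p' < p"
    and slack: "\<And>q. q \<in> \<Theta> \<Longrightarrow> p' < q \<Longrightarrow> q \<le> l \<Longrightarrow> slack \<Theta> (pmf \<sigma>) p' q > 0"
  shows False
proof -
  define f where "f = pmf \<sigma>"
  have f: "f \<in> plans \<Theta> (pmf \<mu>)"
    using \<sigma> by (simp add: f_def optimal_segmentations_def efficient_segmentations_iff)
  have lp: "l \<in> \<Theta>" "p \<in> \<Theta>" "p \<le> l" "f (l, p) > 0"
    using plan_support[OF f] pos by (auto simp: f_def)
  have above: "slack \<Theta> f p q > 0" if "l < q" for q
    using top that types_pos[OF lp(2)] own_type_in_segment[OF fin f lp(4)]
    by (intro slack_pos_above_top[OF fin f]) (auto simp: f_def)
  define d where "d = (\<lambda>x. unit_mass l p' x - unit_mass l p x)"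
  have d_slack: "slack \<Theta> d r q = (if r = p' then p' - (if l \<ge> q then q else 0) else 0)
      - (if r = p then p - (if l \<ge> q then q else 0) else 0)" for r q
    using lp p' by (simp add: d_def plan_linear slack_unit_mass[OF fin])
  have "slack \<Theta> f r q > 0 \<or> slack \<Theta> d r q \<ge> 0" if "q \<in> \<Theta>" "r < q" for r q
    using that above[of q] slack[of q] p' lp types_pos[OF p'(1)] by (auto simp: d_slack f_def)
  moreover have "f x > 0 \<or> d x \<ge> 0" for x
    using lp(4) by (auto simp: d_def unit_mass_def)
  moreover have "d x = 0" if "x \<notin> trade_region \<Theta>" for x
    using that lp p' by (simp add: d_def unit_mass_outside_trade[where \<Theta>=\<Theta>])
  moreover have "(\<Sum>q\<in>\<Theta>. d (t, q)) = 0" for t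
    using lp p' by (simp add: d_def sum_subtractf sum_unit_mass[OF fin])
  ultimately have "feasible_direction \<Theta> f d"
    unfolding feasible_direction_def by blast
  then have "plan_value \<Theta> w d \<le> 0"
    using optimal_direction(1)[OF fin \<mu> \<sigma>] by (simp add: f_def)
  moreover have "plan_value \<Theta> w d = w l p' - w l p"
    using lp p' by (simp add: d_def plan_linear plan_value_unit_mass[OF fin])
  ultimately show False
    using price_decreasing[of l p' p] lp p' by simp
qed

text \<open>Only part of the \<open>k\<close>-types fits into segment \<open>j\<close> (at most \<open>X\<close> of them), segment \<open>k\<close> then
  accommodates all \<open>s\<close>-types, and just barely: at most a small fraction of the \<open>l\<close>-types fits in
  addition.\<close>

lemma critical_masses:
  fixes j k s l :: real
  assumes "0 < j" "j < k" "k < s" "s \<le> l"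
  obtains X mj mk ms ml where "mj > 0" "mk > 0" "ms > 0" "ml > 0" "mj + mk + ms + ml = 1"
    "j * mj = (k - j) * X" "X < mk" "(s - k) * ms \<le> k * (mk - X)"
    "k * mk < (s - k) * (ms + ml)" "l * (k * mk - (s - k) * ms) < (s - k) * k * ms"
proof -
  have k: "0 < k" "k < l" "0 < l" using assms by auto
  \<comment> \<open>Before normalisation by \<open>r\<close> the masses are \<open>mj\<close>,
    \<open>s - k\<close>, \<open>k - e\<close> and \<open>k\<close>. Here \<open>e\<close> bounds
    the amount of \<open>l\<close>-types that fit into segment \<open>k\<close> beside all
    \<open>s\<close>-types; the last inequality becomes \<open>e < k / 2\<close> scaled by positive
    factors.\<close>
  define e where "e = k\<^sup>2 / (2 * l)"
  have le: "l * e = k * (k / 2)" using k by (simp add: e_def power2_eq_square)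
  have e: "0 < e" using k by (simp add: e_def)
  have "l * e < l * (k / 2)" unfolding le using k by (intro mult_strict_right_mono) auto
  then have e2: "e < k / 2" using k by simp
  define X where "X = (s - k) * e / k"
  define mj where "mj = (k - j) * X / j"
  have X: "X > 0" "k * X = (s - k) * e" using k assms e by (auto simp: X_def)
  have mj: "mj > 0" "j * mj = (k - j) * X" using X assms by (auto simp: mj_def)
  have "k * X < k * (s - k)" using X(2) assms e2 k by (simp add: mult.commute)
  then have Xlt: "X < s - k" using k by simp
  define r where "r = 1 / (mj + (s - k) + (k - e) + k)"
  have total: "mj + (s - k) + (k - e) + k > 0" using mj assms e2 k by auto
  then have r: "r > 0" by (simp add: r_def)
  have scale: "r * x < r * y" if "x < y" for x y using that r by simp
  have "l * (k * (s - k) - (s - k) * (k - e)) = (s - k) * (l * e)" by (simp add: algebra_simps)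
  also have "\<dots> = (s - k) * k * (k / 2)" by (simp add: le)
  also have "\<dots> < (s - k) * k * (k - e)" using e2 assms k by (intro mult_strict_left_mono) auto
  finally have last: "l * (k * (s - k) - (s - k) * (k - e)) < (s - k) * k * (k - e)" .
  have "(s - k) * e < (s - k) * k" using e2 assms k by (intro mult_strict_left_mono) auto
  then have third: "k * (s - k) < (s - k) * ((k - e) + k)" by (simp add: algebra_simps)
  show ?thesis
  proof (rule that[of "r * mj" "r * (s - k)" "r * (k - e)" "r * k" "r * X"])
    have "r * mj + r * (s - k) + r * (k - e) + r * k = r * (mj + (s - k) + (k - e) + k)"
      by (simp add: algebra_simps)
    then show "r * mj + r * (s - k) + r * (k - e) + r * k = 1" using total by (simp add: r_def)
    show "j * (r * mj) = (k - j) * (r * X)" using mj(2) by (simp add: mult.left_commute)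
    show "r * X < r * (s - k)" using scale[OF Xlt] .
    have "(s - k) * (r * (k - e)) = r * (k * (s - k) - (s - k) * e)" by (simp add: algebra_simps)
    also have "\<dots> = r * (k * (s - k) - k * X)" by (simp add: X(2))
    finally show "(s - k) * (r * (k - e)) \<le> k * (r * (s - k) - r * X)" by (simp add: algebra_simps)
    show "k * (r * (s - k)) < (s - k) * (r * (k - e) + r * k)"
      using scale[OF third] by (simp add: algebra_simps)
    show "l * (k * (r * (s - k)) - (s - k) * (r * (k - e))) < (s - k) * k * (r * (k - e))"
      using scale[OF last] by (simp add: algebra_simps)
  qed (use r mj assms e2 k in auto)
qed

text \<open>At the critical masses every strongly monotone optimum leaves some \<open>k\<close>-types at price \<open>j\<close>
  and some \<open>l\<close>-types at price \<open>l\<close>, and has all \<open>s\<close>-types at price \<open>k\<close> if \<open>s < l\<close>. Hence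
  the perturbation of \<open>optimal_strongly_monotone\<close> can be run in reverse; by the assumption \<open>weak\<close>
  it does not lower welfare, yet it puts \<open>s\<close>-types into segment \<open>j\<close>.\<close>

lemma optimal_not_strongly_monotone:
  assumes in\<Theta>: "j \<in> \<Theta>" "k \<in> \<Theta>" "s \<in> \<Theta>" "l \<in> \<Theta>" and order: "j < k" "k < s" "s \<le> l"
    and next_type: "\<And>t. t \<in> \<Theta> \<Longrightarrow> k < t \<Longrightarrow> s \<le> t"
    and weak: "(w k j - w k k) - (w s j - w s k) \<le> s / (s - k) * (w l k - w l l)"
  shows "\<exists>\<mu>\<in>distributions \<Theta>. \<exists>\<sigma>\<in>optimal_segmentations \<Theta> w \<mu>. \<not> strongly_monotone \<sigma>"
proof -
  have gt0: "j > 0" "k > 0" "s > 0" "l > 0" using in\<Theta> types_pos by auto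
  obtain X mj mk ms ml where m: "mj > 0" "mk > 0" "ms > 0" "ml > 0" "mj + mk + ms + ml = 1"
    "j * mj = (k - j) * X" "X < mk" "(s - k) * ms \<le> k * (mk - X)"
    "k * mk < (s - k) * (ms + ml)" "l * (k * mk - (s - k) * ms) < (s - k) * k * ms"
    using critical_masses[OF gt0(1) order] by metis
  \<comment> \<open>Summing the indicators covers \<open>s = l\<close>, where the masses
    \<open>ms\<close> and \<open>ml\<close> merge.\<close>
  define g where "g t = (if t = j then mj else 0) + (if t = k then mk else 0) +
    (if t = s then ms else 0) + (if t = l then ml else 0)" for t
  have "sum g \<Theta> = 1"
    using fin in\<Theta> m(5) by (simp add: g_def sum.distrib sum.delta)
  then obtain \<mu> where \<mu>g: "\<And>t. pmf \<mu> t = g t"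
    using pmf_of_weights[of \<Theta> g] fin in\<Theta> m(1-4) by (force simp: g_def)
  then have \<mu>: "\<mu> \<in> distributions \<Theta>"
    using in\<Theta> by (auto simp: distributions_def set_pmf_eq g_def split: if_splits)
  obtain \<sigma> where \<sigma>: "\<sigma> \<in> optimal_segmentations \<Theta> w \<mu>"
    using optimal_segmentation_exists[OF fin types_pos \<mu>] by blast
  have False if all_mono: "\<forall>\<sigma>\<in>optimal_segmentations \<Theta> w \<mu>. strongly_monotone \<sigma>"
  proof -
    \<comment> \<open>Stated for every optimum, since it is applied both to \<open>\<sigma>\<close>
      and to the perturbed \<open>\<tau>\<close>.\<close>
    have mono: "t \<le> p'" if "\<tau> \<in> optimal_segmentations \<Theta> w \<mu>" "pmf \<tau> (t, p) > 0" "pmf \<tau> (t', p') > 0"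
      "p < p'" for \<tau> t p t' p'
    proof -
      have "set_pmf \<tau> \<subseteq> \<Theta> \<times> \<Theta>"
        using that(1) by (auto simp: optimal_segmentations_def efficient_segmentations_def trade_region_def)
      then have "finite (set_pmf \<tau>)" using fin finite_subset by blast
      then show ?thesis using all_mono that strongly_monotone_iff by blast
    qed
    define f where "f = pmf \<sigma>"
    have f: "f \<in> plans \<Theta> (pmf \<mu>)"
      using \<sigma> by (simp add: f_def optimal_segmentations_def efficient_segmentations_iff)
    note f_mono = mono[OF \<sigma>, folded f_def]
    note ge = plans_nonneg[OF f]
    have row_le: "f (t, p) \<le> g t" if "t \<in> \<Theta>" "p \<in> \<Theta>" for t p
      using member_le_sum[of p \<Theta> "\<lambda>p. f (t, p)"] that fin ge plans_row[OF f that(1)] by (simp add: \<mu>g)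
    have supp_t: "t \<in> {j, k, s, l}" if "f (t, p) > 0" for t p
      using row_le[of t p] plan_support[OF f that] that by (auto simp: g_def split: if_splits)
    have supp_p: "p \<in> {j, k, s, l}" if "f (t, p) > 0" for t p
      using supp_t own_type_in_segment[OF fin f that] by blast
    have zero: "f (t, p) = 0" if "\<not> f (t, p) > 0" for t p
      using that ge[of "(t, p)"] by simp
    have below: "f (t, p) = 0" if "t < p" for t p
      using zero plan_support(3)[OF f] that by (metis not_le)
    have row: "f (t, j) + f (t, k) + f (t, s) + (if s = l then 0 else f (t, l)) = g t" if "t \<in> \<Theta>" for t
    proof -
      have "(\<Sum>p\<in>\<Theta>. f (t, p)) = (\<Sum>p\<in>{j, k, s, l}. f (t, p))"
        using fin in\<Theta> zero supp_p by (intro sum.mono_neutral_right) auto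
      then show ?thesis using plans_row[OF f that] order by (auto simp: \<mu>g)
    qed
    define col where "col p q = (\<Sum>t\<in>{t\<in>\<Theta>. t \<ge> q}. f (t, p))" for p q
    have slack_col: "slack \<Theta> f p q = p * col p p - q * col p q" for p q
      by (simp add: slack_def col_def)
    have col: "col p q = (if j \<ge> q then f (j, p) else 0) + (if k \<ge> q then f (k, p) else 0) +
      (if s \<ge> q then f (s, p) else 0) + (if l \<ge> q \<and> s \<noteq> l then f (l, p) else 0)" for p q
    proof -
      have "col p q = (\<Sum>t\<in>{t\<in>{j, k, s, l}. t \<ge> q}. f (t, p))"
        unfolding col_def using fin in\<Theta> zero supp_t by (intro sum.mono_neutral_right) auto
      also have "\<dots> = (\<Sum>t\<in>{j, k, s, l}. if t \<ge> q then f (t, p) else 0)"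
        by (subst sum.inter_filter) auto
      finally show ?thesis by (cases "s = l") (use order in auto)
    qed
    have fjj: "f (j, j) = mj"
      using row[OF in\<Theta>(1)] order below[of j k] below[of j s] below[of j l]
      by (simp add: g_def split: if_splits)
    have fk: "f (k, j) + f (k, k) = mk"
      using row[OF in\<Theta>(2)] order below[of k s] below[of k l]
      by (simp add: g_def split: if_splits)
    have slack_jk: "(k - j) * col j k \<le> j * mj"
    proof -
      have "col j j = mj + col j k" using order by (simp add: col fjj)
      then show ?thesis
        using plans_obedient[OF f in\<Theta>(1,2)] by (simp add: slack_col algebra_simps)
    qed
    have f_above_k: "f (t, j) = 0" if "k < t" for t
    proof (rule zero, rule notI)
      assume tj: "f (t, j) > 0"
      have "f (k, k) = 0"
        using zero f_mono[OF tj _ order(1), of k] that by fastforce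
      then have "mk \<le> col j k"
        using fk ge order by (simp add: col)
      then have "(k - j) * mk \<le> (k - j) * X"
        using slack_jk m(6) order mult_left_mono[of mk "col j k" "k - j"] by simp
      then show False using m(7) order by simp
    qed
    have "col j k = f (k, j)" using f_above_k order by (simp add: col)
    then have "f (k, j) \<le> X" using slack_jk m(6) order by simp
    then have fkk: "mk - X \<le> f (k, k)" "f (k, k) > 0" using fk m(7) by auto
    have fkk_le: "f (k, k) \<le> mk" using fk ge[of "(k, j)"] by simp
    have col_kk: "col k k = f (k, k) + col k s" using order below[of j k] by (simp add: col)
    \<comment> \<open>If price \<open>s\<close> were used, monotonicity would keep \<open>l\<close>
      out of segment \<open>k\<close>, and some \<open>s\<close>-types would be missing there too.
      Segment \<open>k\<close> would then have slack to attract \<open>l\<close> from a higher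
      price.\<close>
    have price_s: "f (t, s) = 0" if "s < l" for t
    proof (rule zero, rule notI)
      assume "f (t, s) > 0"
      then have fss: "f (s, s) > 0" using own_type_in_segment[OF fin f] by blast
      have flk: "f (l, k) = 0"
        using zero f_mono[OF _ fss order(2), of l] that by fastforce
      have fsk: "f (s, k) < ms"
        using row[OF in\<Theta>(3)] order that fss ge[of "(s, j)"] ge[of "(s, l)"] by (auto simp: g_def split: if_splits)
      have slack_k: "slack \<Theta> f k q > 0" if "q \<in> \<Theta>" "k < q" for q
      proof (cases "q = s")
        case True
        have "(s - k) * f (s, k) < (s - k) * ms" using fsk order by simp
        also have "\<dots> \<le> k * f (k, k)" using m(8) fkk(1) gt0(2) by (meson mult_left_mono order_trans less_imp_le)
        finally show ?thesis
          using True order flk \<open>s < l\<close> by (simp add: slack_col col_kk) (simp add: col algebra_simps)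
      next
        case False
        then have "s < q" using next_type that by force
        have "f (t, k) = 0" if "t \<in> \<Theta>" "q \<le> t" for t
          using zero supp_t[of t k] that \<open>s < q\<close> order flk by fastforce
        then show ?thesis
          using gt0(2) fkk(2) by (intro slack_pos_above_top[OF fin f]) auto
      qed
      have "f (l, s) > 0 \<or> f (l, l) > 0"
        using row[OF in\<Theta>(4)] f_above_k[of l] flk m(4) order \<open>s < l\<close> ge[of "(l, s)"] ge[of "(l, l)"]
        by (simp add: g_def) linarith
      then obtain p where "f (l, p) > 0" "k < p"
        using order \<open>s < l\<close> by force
      moreover have "f (t, p) = 0" if "l < t" for t p
        using zero supp_t[of t p] that order by fastforce
      ultimately show False
        using no_improving_top_move[OF \<mu> \<sigma>, of l p k] slack_k in\<Theta> by (simp add: f_def)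
    qed
    have "(s - k) * col k s \<le> k * f (k, k)"
      using plans_obedient[OF f in\<Theta>(2,3)] by (simp add: slack_col col_kk algebra_simps)
    also have "\<dots> \<le> k * mk" using fkk_le gt0 by simp
    finally have col_ks: "(s - k) * col k s \<le> k * mk" .
    \<comment> \<open>Segment \<open>k\<close> cannot hold all types from \<open>s\<close> upwards,
      so some \<open>l\<close>-types are left to pay \<open>l\<close>.\<close>
    have "col k s < ms + ml"
      using order(2) by (intro mult_left_less_imp_less[of "s - k" "col k s"] le_less_trans[OF col_ks m(9)]) auto
    then have fll: "f (l, l) > 0"
      using row[OF in\<Theta>(3)] row[OF in\<Theta>(4)] f_above_k price_s order below[of s l]
      by (cases "s = l") (auto simp: g_def col split: if_splits)
    have fsk: "f (s, k) = ms" if "s < l"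
      using row[OF in\<Theta>(3)] f_above_k price_s[OF that] order that below[of s l]
      by (auto simp: g_def split: if_splits)
    have above_l: "f (t, p) = 0" if "l < t" for t p
      using zero supp_t[of t p] that order by fastforce
    \<comment> \<open>Otherwise segment \<open>j\<close> consists of type \<open>j\<close> alone and
      has slack to take in \<open>l\<close>-types now paying \<open>l\<close>.\<close>
    have fkj: "f (k, j) > 0"
    proof (rule ccontr)
      assume "\<not> f (k, j) > 0"
      then have "f (t, j) = 0" if "j < t" for t
        using zero supp_t[of t j] that order f_above_k[of t] by fastforce
      then have "slack \<Theta> f j q > 0" if "j < q" for q
        using that gt0 fjj m(1) by (intro slack_pos_above_top[OF fin f]) auto
      then show False
        using no_improving_top_move[OF \<mu> \<sigma>, of l l j] fll above_l in\<Theta> order by (simp add: f_def)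
    qed
    define c where "c = s / (s - k)"
    have c: "c > 1" "c * (s - k) = s" using order gt0 by (auto simp: c_def)
    define d where "d = (\<lambda>x. unit_mass k k x - unit_mass k j x + unit_mass s j x - unit_mass s k x
      + c * (unit_mass l k x - unit_mass l l x))"
    have d_slack: "slack \<Theta> d p q =
        (if p = k then k - (if k \<ge> q then q else 0) else 0) - (if p = j then j - (if k \<ge> q then q else 0) else 0)
      + (if p = j then j - (if s \<ge> q then q else 0) else 0) - (if p = k then k - (if s \<ge> q then q else 0) else 0)
      + c * ((if p = k then k - (if l \<ge> q then q else 0) else 0)
           - (if p = l then l - (if l \<ge> q then q else 0) else 0))" for p q
      using order by (simp add: d_def plan_linear slack_unit_mass[OF fin] in\<Theta>)
    have "slack \<Theta> f p q > 0 \<or> slack \<Theta> d p q \<ge> 0" if q: "q \<in> \<Theta>" "p < q" for p q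
    proof -
      consider "p = j" | "p = k" | "p = l" | "p \<notin> {j, k, l}" by blast
      then show ?thesis
      proof cases
        case 1
        show ?thesis
        proof (cases "k < q")
          case True
          then have "slack \<Theta> f j q > 0"
            using f_above_k gt0 fjj m(1) by (intro slack_pos_above_top[OF fin f]) auto
          then show ?thesis using 1 by simp
        next
          case False
          then show ?thesis using 1 order by (simp add: d_slack)
        qed
      next
        case 2
        consider "l < q" | "q = s" | "s < q" "q \<le> l" using next_type[OF q(1)] q(2) 2 by linarith
        then show ?thesis
        proof cases
          case 1
          then show ?thesis using 2 order gt0 c by (simp add: d_slack)
        next
          \<comment> \<open>The choice of \<open>c\<close> makes the change at \<open>q = s\<close>
            exactly zero, so this constraint survives even if it binds.\<close>
          case 2
          then show ?thesis using \<open>p = k\<close> order c by (simp add: d_slack algebra_simps)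
        next
          \<comment> \<open>Here the direction does reduce the slack, by \<open>c * (q - k)\<close>.
            The last inequality of \<open>critical_masses\<close> keeps \<open>l\<close>-types in
            segment \<open>k\<close> so scarce that the slack is positive beforehand.\<close>
          case 3
          have "s < l" using 3 by simp
          have cks: "col k s = ms + f (l, k)" using \<open>s < l\<close> order by (simp add: col fsk)
          have "(s - k) * f (l, k) \<le> k * mk - (s - k) * ms"
            using col_ks by (simp add: cks algebra_simps)
          then have "l * ((s - k) * f (l, k)) < (s - k) * k * ms"
            using m(10) gt0(4) by (meson le_less_trans mult_left_mono less_imp_le)
          then have "(s - k) * (l * f (l, k)) < (s - k) * (k * ms)"
            by (simp add: algebra_simps)
          then have "l * f (l, k) < k * ms" using order by simp
          moreover have "q * col k q \<le> l * f (l, k)"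
            using 3 order ge[of "(l, k)"] by (simp add: col mult_right_mono)
          moreover have "k * ms \<le> k * col k k"
            using gt0 fkk ge[of "(l, k)"] by (simp add: col_kk cks)
          ultimately show ?thesis using 2 by (simp add: slack_col)
        qed
      next
        case 3
        have "slack \<Theta> f l q > 0"
          using q 3 above_l gt0 fll by (intro slack_pos_above_top[OF fin f]) auto
        then show ?thesis using 3 by simp
      next
        case 4
        then show ?thesis by (simp add: d_slack)
      qed
    qed
    moreover have "f x > 0 \<or> d x \<ge> 0" for x
    \<comment> \<open>For \<open>s = l\<close> the entry at \<open>(s, k)\<close> is
      \<open>c - 1 > 0\<close>, so the point needs positive mass only if
      \<open>s < l\<close>.\<close>
    proof (cases "x = (k, j) \<or> x = (l, l) \<or> x = (s, k) \<and> s < l")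
      case True
      then show ?thesis using fkj fll fsk m(3) by auto
    next
      case False
      then show ?thesis using c(1) order by (auto simp: d_def unit_mass_def)
    qed
    moreover have "d x = 0" if "x \<notin> trade_region \<Theta>" for x
      using that in\<Theta> order by (simp add: d_def unit_mass_outside_trade[where \<Theta>=\<Theta>])
    moreover have "(\<Sum>q\<in>\<Theta>. d (t, q)) = 0" for t
      by (simp add: d_def sum.distrib sum_subtractf sum_unit_mass[OF fin] in\<Theta> flip: sum_distrib_left)
    ultimately have "feasible_direction \<Theta> (pmf \<sigma>) d"
      unfolding feasible_direction_def f_def by blast
    note dir = optimal_direction[OF fin \<mu> \<sigma> this]
    have "plan_value \<Theta> w d = w k k - w k j + w s j - w s k + c * (w l k - w l l)"
      by (simp add: d_def plan_linear plan_value_unit_mass[OF fin] in\<Theta>)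
    \<comment> \<open>Optimality gives one inequality, the assumption \<open>weak\<close> the
      other.\<close>
    then have "plan_value \<Theta> w d = 0"
      using dir(1) weak by (simp add: c_def)
    then obtain \<tau> e where \<tau>: "\<tau> \<in> optimal_segmentations \<Theta> w \<mu>" "e > 0" "pmf \<tau> = (\<lambda>x. f x + e * d x)"
      using dir(2) unfolding f_def by blast
    \<comment> \<open>The new optimum sells to \<open>s\<close> at \<open>j\<close> while price
      \<open>k\<close>, strictly between \<open>j\<close> and \<open>s\<close>, is in use.\<close>
    have "d (s, j) = 1" "d (k, k) = 1"
      using order by (auto simp: d_def unit_mass_def)
    then have "pmf \<tau> (s, j) > 0" "pmf \<tau> (k, k) > 0"
      using \<tau>(2) ge by (simp_all add: \<tau>(3) add_nonneg_pos)
    then show False using mono[OF \<tau>(1) _ _ order(1)] order(2) by force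
  qed
  then show ?thesis using \<mu> by blast
qed

end

section \<open>Translation to indexed types\<close>

theorem proposition2:
  fixes \<theta> :: "nat \<Rightarrow> real" and K :: nat and w :: "real \<Rightarrow> real \<Rightarrow> real"
  assumes "K \<ge> 1"
    and "strict_mono_on {1..K} \<theta>"
    and "\<theta> 1 > 0"
    and "strictly_redistributive \<theta> K w"
  shows "(\<forall>\<mu>\<in>distributions (\<theta> ` {1..K}). \<forall>\<sigma>\<in>optimal_segmentations (\<theta> ` {1..K}) w \<mu>.
            strongly_monotone \<sigma>)
         \<longleftrightarrow> strongly_redistributive \<theta> K w"
proof -
  have less: "\<theta> a < \<theta> b \<longleftrightarrow> a < b" if "a \<in> {1..K}" "b \<in> {1..K}" for a b
    using strict_mono_on_less[OF assms(2)] that by blast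
  interpret redistributive_market "\<theta> ` {1..K}" w
  proof
    fix t assume "t \<in> \<theta> ` {1..K}"
    then obtain a where "a \<in> {1..K}" "t = \<theta> a" by auto
    then show "t > 0" using less[of 1 a] assms(1,3) by (cases "a = 1") auto
  next
    fix t p q assume "t \<in> \<theta> ` {1..K}" "p \<in> \<theta> ` {1..K}" "q \<in> \<theta> ` {1..K}" "p < q" "q \<le> t"
    then obtain a b c where abc: "a \<in> {1..K}" "t = \<theta> a" "b \<in> {1..K}" "p = \<theta> b" "c \<in> {1..K}" "q = \<theta> c"
      by auto
    have "b < c" "c \<le> a"
      using less[of b c] less[of a c] abc \<open>p < q\<close> \<open>q \<le> t\<close> by auto
    then have "p \<in> \<theta> ` {1..a}" "q \<in> \<theta> ` {1..a}"
      using abc by auto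
    moreover have "strict_antimono_on (\<theta> ` {1..a}) (w t)"
      using assms(4) abc unfolding strictly_redistributive_def Let_def by blast
    ultimately show "w t q < w t p"
      using \<open>p < q\<close> by (auto dest: monotone_onD)
  next
    show "w t' p - w t' p' < w t p - w t p'" if "t \<in> \<theta> ` {1..K}" "t' \<in> \<theta> ` {1..K}"
      "p \<in> \<theta> ` {1..K}" "p' \<in> \<theta> ` {1..K}" "t < t'" "p' \<le> t" "p < p'" for t t' p p'
      using assms(4) that unfolding strictly_redistributive_def Let_def by blast
  qed auto
  have next_type: "\<theta> (a + 1) \<le> t" if "a \<in> {1..K}" "a + 1 \<in> {1..K}" "t \<in> \<theta> ` {1..K}" "\<theta> a < t" for a t
  proof -
    from that(3) obtain b where "b \<in> {1..K}" "t = \<theta> b" by auto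
    then show ?thesis using less[of a b] less[of "b" "a + 1"] that by auto
  qed
  show ?thesis
  proof
    assume strong: "strongly_redistributive \<theta> K w"
    have ineq: "s / (s - k) * (w l k - w l l) < (w k p - w k k) - (w s p - w s k)"
      if "p \<in> \<theta> ` {1..K}" "k \<in> \<theta> ` {1..K}" "s \<in> \<theta> ` {1..K}" "l \<in> \<theta> ` {1..K}" "p < k" "k < s" "s \<le> l"
        "\<And>t. t \<in> \<theta> ` {1..K} \<Longrightarrow> k < t \<Longrightarrow> s \<le> t" for p k s l
    proof -
      from that(2-4) obtain a b c where
        ab: "a \<in> {1..K}" "k = \<theta> a" "b \<in> {1..K}" "s = \<theta> b" "c \<in> {1..K}" "l = \<theta> c"
        by auto
      \<comment> \<open>The type \<open>s\<close> above \<open>k\<close> shows that \<open>a\<close>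
        is not the last index; as the least such type, \<open>s\<close> equals
        \<open>\<theta> (a + 1)\<close>.\<close>
      then have a1: "a + 1 \<in> {1..K}" using less[of a b] that by auto
      then have "\<theta> (a + 1) \<le> s" using next_type ab that by blast
      moreover have "s \<le> \<theta> (a + 1)" using that(8)[of "\<theta> (a + 1)"] less[of a "a + 1"] ab a1 by auto
      ultimately have "s = \<theta> (a + 1)" by simp
      moreover have "k < l" using that by simp
      ultimately show ?thesis
        using strong that(1,5) ab unfolding strongly_redistributive_def by blast
    qed
    show "\<forall>\<mu>\<in>distributions (\<theta> ` {1..K}). \<forall>\<sigma>\<in>optimal_segmentations (\<theta> ` {1..K}) w \<mu>.
        strongly_monotone \<sigma>"
    proof (intro ballI)
      fix \<mu> \<sigma>
      assume "\<mu> \<in> distributions (\<theta> ` {1..K})" "\<sigma> \<in> optimal_segmentations (\<theta> ` {1..K}) w \<mu>"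
      then show "strongly_monotone \<sigma>"
        by (rule optimal_strongly_monotone) (fact ineq)
    qed
  next
    assume mono: "\<forall>\<mu>\<in>distributions (\<theta> ` {1..K}). \<forall>\<sigma>\<in>optimal_segmentations (\<theta> ` {1..K}) w \<mu>.
        strongly_monotone \<sigma>"
    have "\<theta> (a + 1) / (\<theta> (a + 1) - \<theta> a) * (w (\<theta> b) (\<theta> a) - w (\<theta> b) (\<theta> b))
        < (w (\<theta> a) p - w (\<theta> a) (\<theta> a)) - (w (\<theta> (a + 1)) p - w (\<theta> (a + 1)) (\<theta> a))"
      if "p \<in> \<theta> ` {1..K}" "a \<in> {1..K}" "b \<in> {1..K}" "p < \<theta> a" "\<theta> a < \<theta> b" for p a b
    proof (rule ccontr)
      assume not: "\<not> ?thesis"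
      have a1: "a + 1 \<in> {1..K}" using less[of a b] that by auto
      then have "\<theta> a < \<theta> (a + 1)" using less[of a "a + 1"] that by auto
      then have "\<exists>\<mu>\<in>distributions (\<theta> ` {1..K}). \<exists>\<sigma>\<in>optimal_segmentations (\<theta> ` {1..K}) w \<mu>.
          \<not> strongly_monotone \<sigma>"
        using that a1 not next_type
        by (intro optimal_not_strongly_monotone[of p "\<theta> a" "\<theta> (a + 1)" "\<theta> b"]) auto
      then show False using mono by blast
    qed
    then show "strongly_redistributive \<theta> K w"
      using assms(4) unfolding strongly_redistributive_def by blast
  qed
qed

end
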